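(* Let $\{a_n\}_{n\ge 0}$ be a sequence of real numbers, with $a_n\neq 0$ for all sufficiently large $n$, such that, as $n\to\infty$, \[ \frac{a_{n-1}a_{n+1}}{a_n^2} = 1+\sum_{i=1}^m \frac{r_i(\log n)}{n^{\alpha_i}} + o\left(\frac{1}{n^{\beta}}\right), \] where $m\ge 1$ is an integer, $\alpha_1,\dots,\alpha_m,\beta$ are real numbers with $0<\alpha_1<\alpha_2<\cdots<\alpha_m<\beta$, and $r_1(x),\dots,r_m(x)$ are rational functions of $x$ with real coefficients. Assume that $\alpha_m-\alpha_1\ge 1$. If either (i) $0<\alpha_1<2$ and $r_1(x)<0$ for all sufficiently large $x$, or (ii) $\alpha_1=2$ and $r_1(x)<-1$ for all sufficiently large $x$, then $\{a_n\}_{n\ge 0}$ satisfies the higher order Turán inequalities asymptotically.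
   Context: A real sequence $\{a_n\}_{n\ge 0}$ satisfies the higher order Turán inequalities asymptotically if \[ 4(a_n^2-a_{n-1}a_{n+1})(a_{n+1}^2-a_na_{n+2})-(a_na_{n+1}-a_{n-1}a_{n+2})^2\ge 0 \] holds for all sufficiently large $n$. *)

theory Defs
  imports Complex_Main "HOL-Library.Landau_Symbols" "HOL-Computational_Algebra.Polynomial"
begin

(* A real rational function, viewed as a function on the reals. The values at the finitely many
   zeros of the chosen denominator are left unconstrained. *)
definition rational_function :: "(real \<Rightarrow> real) \<Rightarrow> bool" where
  "rational_function r \<longleftrightarrow>
     (\<exists>p q :: real poly. q \<noteq> 0 \<and> (\<forall>x. poly q x \<noteq> 0 \<longrightarrow> r x = poly p x / poly q x))"

(* The truncated subtraction n - 1 only deviates at n = 0, which is irrelevant here. *)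
definition higher_order_turan_asymptotically :: "(nat \<Rightarrow> real) \<Rightarrow> bool" where
  "higher_order_turan_asymptotically a \<longleftrightarrow>
     (\<forall>\<^sub>F n in sequentially.
        4 * ((a n)\<^sup>2 - a (n - 1) * a (n + 1)) * ((a (n + 1))\<^sup>2 - a n * a (n + 2))
          - (a n * a (n + 1) - a (n - 1) * a (n + 2))\<^sup>2 \<ge> 0)"

end

theory Submission
  imports Defs "HOL-Real_Asymp.Real_Asymp"
begin

text \<open>
  Put \<open>x\<^sub>n = 1 - a\<^bsub>n-1\<^esub> a\<^bsub>n+1\<^esub> / a\<^sub>n\<^sup>2\<close>. Dividing by \<open>(a\<^sub>n a\<^bsub>n+1\<^esub>)\<^sup>2\<close> turns the
  Turan expression into \<open>2 x y (x + y) - (x y)\<^sup>2 - (x - y)\<^sup>2\<close> with \<open>x = x\<^sub>n\<close>, \<open>y = x\<^bsub>n+1\<^esub>\<close>.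
  With \<open>R = - r\<^sub>1(log n)\<close> the hypotheses give \<open>x \<approx> y \<approx> R / n\<^sup>\<alpha>\<close> and, since \<open>\<beta> > \<alpha> + 1\<close>,
  \<open>x - y \<approx> \<alpha> R / n\<^bsup>\<alpha>+1\<^esup>\<close>, so the sign is that of \<open>4 R n\<^bsup>2-\<alpha>\<^esup> - \<alpha>\<^sup>2\<close>: the first term tends
  to infinity if \<open>\<alpha> < 2\<close>, while for \<open>\<alpha> = 2\<close> one gets \<open>4 (R - 1)\<close>. As \<open>R\<close> may tend to 1, all relative
  errors are then needed to order \<open>o((R - 1) / R)\<close>. They are polynomially small, except for the one from
  the variation of \<open>R\<close>, and a rational function \<open>s\<close> of \<open>log n\<close>, here \<open>s = R - 1\<close>, changes only by
  \<open>o(s / n)\<close> in one step.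
\<close>

section \<open>Rational functions near infinity\<close>

text \<open>The denominator has only finitely many zeros, so the unconstrained values of
  \<open>r\<close> there disappear at infinity.\<close>

lemma rational_function_eventually:
  assumes "rational_function r"
  obtains p q where "q \<noteq> 0"
    "\<forall>\<^sub>F x in at_top. poly q x \<noteq> 0 \<and> r x = poly p x / poly q x"
proof -
  from assms obtain p q where q: "q \<noteq> 0"
    and r: "\<And>x. poly q x \<noteq> 0 \<Longrightarrow> r x = poly p x / poly q x"
    unfolding rational_function_def by blast
  have "\<forall>\<^sub>F x in at_top. poly q x \<noteq> 0"
    using poly_eventually_not_zero[OF q] by (rule filter_leD[OF at_top_le_at_infinity])
  then have "\<forall>\<^sub>F x in at_top. poly q x \<noteq> 0 \<and> r x = poly p x / poly q x"
    by eventually_elim (simp add: r)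
  then show ?thesis by (rule that[OF q])
qed

lemma rational_function_minus:
  assumes "rational_function r"
  shows "rational_function (\<lambda>x. - r x)"
proof -
  from assms obtain p q where "q \<noteq> 0" and "\<forall>x. poly q x \<noteq> 0 \<longrightarrow> r x = poly p x / poly q x"
    unfolding rational_function_def by blast
  then show ?thesis unfolding rational_function_def
    by (intro exI[of _ "- p"] exI[of _ q]) simp
qed

lemma rational_function_diff_1:
  assumes "rational_function r"
  shows "rational_function (\<lambda>x. r x - 1)"
proof -
  from assms obtain p q where "q \<noteq> 0" and "\<forall>x. poly q x \<noteq> 0 \<longrightarrow> r x = poly p x / poly q x"
    unfolding rational_function_def by blast
  then show ?thesis unfolding rational_function_def
    by (intro exI[of _ "p - q"] exI[of _ q]) (simp add: diff_divide_distrib)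
qed

section \<open>Polynomials in \<open>ln n\<close>: size and relative change over one step\<close>

lemma filterlim_ln_nat: "filterlim (\<lambda>n::nat. ln (real n)) at_top sequentially"
  by real_asymp

lemma eventually_ln_nat: "eventually P at_top \<Longrightarrow> \<forall>\<^sub>F n in sequentially. P (ln (real n))"
  by (rule eventually_compose_filterlim[OF _ filterlim_ln_nat])

text \<open>Induction over the coefficients, with \<epsilon> arbitrary so that it can be halved: one
  half absorbs the factor \<open>ln n\<close>, the other half the shorter polynomial.\<close>

lemma poly_ln_smallo_powr:
  fixes p :: "real poly"
  assumes "\<epsilon> > 0"
  shows "(\<lambda>n. poly p (ln (real n))) \<in> o(\<lambda>n. real n powr \<epsilon>)"
  using assms
proof (induction p arbitrary: \<epsilon>)
  case (pCons c p)
  have "(\<lambda>n. c) \<in> o(\<lambda>n. real n powr \<epsilon>)"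
    using pCons.prems by real_asymp
  moreover have "(\<lambda>n. ln (real n) * poly p (ln (real n)))
      \<in> o(\<lambda>n. real n powr (\<epsilon>/2) * real n powr (\<epsilon>/2))"
    using pCons.prems by (intro landau_o.small_mult pCons.IH) (real_asymp, simp)
  ultimately show ?case
    by (auto simp flip: powr_add intro: sum_in_smallo)
qed simp

text \<open>Near infinity a nonzero polynomial is, in absolute value, at least its leading
  coefficient. Since \<open>p\<close> may be constant, boundedness is all that can be
  claimed.\<close>

lemma inverse_poly_ln_bounded:
  fixes p :: "real poly"
  assumes "p \<noteq> 0"
  shows "(\<lambda>n. 1 / poly p (ln (real n))) \<in> O(\<lambda>_. 1)"
proof -
  have *: "\<forall>\<^sub>F x in at_top. \<bar>poly p x\<bar> \<ge> \<bar>lead_coeff p\<bar>"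
  proof (cases "lead_coeff p > 0")
    case True
    then show ?thesis using poly_pinfty_gt_lc[of p]
      by (fastforce simp: eventually_at_top_linorder)
  next
    case False
    then have "lead_coeff (- p) > 0" using assms by (simp add: order_less_le)
    then show ?thesis using poly_pinfty_gt_lc[of "- p"]
      by (fastforce simp: eventually_at_top_linorder)
  qed
  have "\<forall>\<^sub>F n in sequentially. norm (1 / poly p (ln (real n))) \<le> 1 / \<bar>lead_coeff p\<bar> * norm (1::real)"
    using eventually_ln_nat[OF *]
    by eventually_elim (use assms in \<open>auto simp: divide_simps split: if_splits\<close>)
  then show ?thesis by (rule bigoI)
qed

text \<open>
  Mean value theorem for \<open>log p(log t)\<close>, whose derivative is \<open>(p' / p)(log t) / t\<close> with \<open>p' / p \<rightarrow> 0\<close>.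
\<close>
lemma poly_ln_ratio:
  fixes p :: "real poly"
  assumes "p \<noteq> 0"
  shows "(\<lambda>n. real n * (poly p (ln (real (Suc n))) / poly p (ln (real n)) - 1)) \<longlonglongrightarrow> 0"
proof -
  \<comment> \<open>The logarithm of \<open>p\<close> requires a positive leading coefficient; the
    ratio does not change when \<open>p\<close> is replaced by \<open>- p\<close>, which covers the
    other sign.\<close>
  have pos: "(\<lambda>n. real n * (poly p (ln (real (Suc n))) / poly p (ln (real n)) - 1)) \<longlonglongrightarrow> 0"
    if lc: "lead_coeff p > 0" for p :: "real poly"
  proof -
    define l where "l x = poly (pderiv p) x / poly p x" for x
    have p0: "p \<noteq> 0" using lc by auto
    have l0: "(l \<longlongrightarrow> 0) at_top"
    proof (cases "degree p = 0")
      case True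
      then have "pderiv p = 0" by (simp add: pderiv_eq_0_iff)
      then show ?thesis unfolding l_def by simp
    next
      case False
      then have "degree (pderiv p) < degree p" by (simp add: degree_pderiv)
      from tendsto_mono[OF at_top_le_at_infinity poly_divide_tendsto_0_at_infinity[OF this]]
      show ?thesis unfolding l_def .
    qed
    obtain B where B: "\<And>x. x \<ge> B \<Longrightarrow> poly p x \<ge> lead_coeff p"
      using poly_pinfty_gt_lc[OF lc] by blast
    have ppos: "poly p x > 0" if "x \<ge> B" for x using B[OF that] lc by linarith
    define z where "z n = ln (poly p (ln (real (Suc n)))) - ln (poly p (ln (real n)))" for n
    have evB: "\<forall>\<^sub>F n in sequentially. n \<ge> 1 \<and> ln (real n) \<ge> B"
      using eventually_conj[OF eventually_ge_at_top[of 1] eventually_ln_nat[OF eventually_ge_at_top[of B]]] .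
    have nz: "(\<lambda>n. real n * z n) \<longlonglongrightarrow> 0"
    proof (rule tendstoI)
      fix e :: real assume e: "e > 0"
      have "\<forall>\<^sub>F x in at_top. \<bar>l x\<bar> < e" using tendstoD[OF l0 e] by simp
      then obtain C where C: "\<And>x. x \<ge> C \<Longrightarrow> \<bar>l x\<bar> < e" by (auto simp: eventually_at_top_linorder)
      have "\<forall>\<^sub>F n in sequentially. ln (real n) \<ge> C"
        by (rule eventually_ln_nat[OF eventually_ge_at_top])
      with evB show "\<forall>\<^sub>F n in sequentially. dist (real n * z n) 0 < e"
      proof eventually_elim
        case (elim n)
        have "\<exists>t. real n < t \<and> t < real (Suc n) \<and> z n = (real (Suc n) - real n) * (l (ln t) / t)"
          unfolding z_def
        proof (rule MVT2)
          fix t assume t: "real n \<le> t" "t \<le> real (Suc n)"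
          have t0: "t > 0" and "ln t \<ge> B" using t elim ln_mono[of "real n" t] by linarith+
          then show "((\<lambda>t. ln (poly p (ln t))) has_real_derivative l (ln t) / t) (at t)"
            unfolding l_def using ppos[of "ln t"]
            by (auto intro!: derivative_eq_intros simp: divide_simps)
        qed simp
        then obtain t where t: "real n < t" "z n = l (ln t) / t" by auto
        have "\<bar>l (ln t)\<bar> < e" using C[of "ln t"] t elim ln_mono[of "real n" t] by linarith
        moreover have "\<bar>real n * z n\<bar> \<le> \<bar>l (ln t)\<bar>"
        proof -
          have "\<bar>real n * z n\<bar> = (real n / t) * \<bar>l (ln t)\<bar>"
            using t elim by (simp add: abs_mult)
          also have "\<dots> \<le> 1 * \<bar>l (ln t)\<bar>"
            using t by (intro mult_right_mono) auto
          finally show ?thesis by simp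
        qed
        ultimately show ?case by simp
      qed
    qed
    have z0: "z \<longlonglongrightarrow> 0"
    proof (rule Lim_transform_eventually)
      show "(\<lambda>n. real n * z n * (1 / real n)) \<longlonglongrightarrow> 0"
        using tendsto_mult[OF nz lim_1_over_n] by simp
      show "\<forall>\<^sub>F n in sequentially. real n * z n * (1 / real n) = z n"
        using eventually_gt_at_top[of 0] by eventually_elim simp
    qed
    have "\<forall>\<^sub>F n in sequentially. norm (real n * (poly p (ln (real (Suc n))) / poly p (ln (real n)) - 1))
        \<le> norm (real n * z n) * 2"
      using evB tendstoD[OF z0, of "1/2", simplified]
    proof eventually_elim
      case (elim n)
      have "ln (real n) \<le> ln (real (Suc n))" using elim by (intro ln_mono) auto
      then have "ln (real (Suc n)) \<ge> B" using elim by linarith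
      then have "poly p (ln (real (Suc n))) / poly p (ln (real n)) = exp (z n)"
        unfolding z_def using elim ppos by (simp add: exp_diff)
      \<comment> \<open>For \<open>z n \<ge> 0\<close> this uses \<open>z n \<le> 1/2\<close>, the
        reason for the tolerance taken from \<open>z0\<close>; for negative \<open>z n\<close> it
        follows from \<open>1 + z \<le> exp z\<close>.\<close>
      moreover have "\<bar>exp (z n) - 1\<bar> \<le> 2 * \<bar>z n\<bar>"
      proof (cases "z n \<ge> 0")
        case True
        then show ?thesis using real_exp_bound_lemma[of "z n"] elim by auto
      next
        case False
        then have "exp (z n) \<le> 1" by simp
        with False show ?thesis using exp_ge_add_one_self[of "z n"] by linarith
      qed
      ultimately show ?case using mult_left_mono[of "\<bar>exp (z n) - 1\<bar>" "2 * \<bar>z n\<bar>" "real n"]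
        by (simp add: abs_mult del: of_nat_Suc)
    qed
    then show ?thesis by (rule tendsto_0_le[OF nz])
  qed
  show ?thesis
  proof (cases "lead_coeff p > 0")
    case False
    then have "lead_coeff (- p) > 0" using assms by (simp add: order_less_le)
    from pos[OF this] show ?thesis by simp
  qed (rule pos)
qed

section \<open>Rational functions of \<open>ln n\<close>: change over one step and comparison with
  powers of \<open>n\<close>\<close>

text \<open>The quotient of consecutive values is \<open>P / Q\<close>, where \<open>P\<close> and
  \<open>Q\<close> are the corresponding quotients for numerator and denominator, both
  \<open>1 + o(1/n)\<close>; hence \<open>P / Q - 1 = (P - Q) / Q\<close> is \<open>o(1/n)\<close>.
  The error is relative to \<open>r\<close> itself, which matters when \<open>r\<close> tends to
  0.\<close>

lemma rational_ln_step:
  assumes "rational_function r"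
  shows "(\<lambda>n. r (ln (real (Suc n))) - r (ln (real n))) \<in> o(\<lambda>n. r (ln (real n)) / real n)"
proof -
  obtain p q where q: "q \<noteq> 0"
    and r: "\<forall>\<^sub>F x in at_top. poly q x \<noteq> 0 \<and> r x = poly p x / poly q x"
    using assms by (rule rational_function_eventually)
  have r1: "\<forall>\<^sub>F n in sequentially. poly q (ln (real n)) \<noteq> 0 \<and>
      r (ln (real n)) = poly p (ln (real n)) / poly q (ln (real n))"
    using eventually_ln_nat[OF r] .
  have r2: "\<forall>\<^sub>F n in sequentially. poly q (ln (real (Suc n))) \<noteq> 0 \<and>
      r (ln (real (Suc n))) = poly p (ln (real (Suc n))) / poly q (ln (real (Suc n)))"
    using r1 by (rule eventually_sequentially_Suc[THEN iffD2])
  show ?thesis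
  \<comment> \<open>For \<open>p = 0\<close> the quotient \<open>P\<close> is meaningless, but then
    \<open>r\<close> vanishes near infinity and so does the difference.\<close>
  proof (cases "p = 0")
    case True
    have "\<forall>\<^sub>F n in sequentially. r (ln (real (Suc n))) - r (ln (real n)) = 0"
      using r1 r2 by eventually_elim (simp add: True)
    then show ?thesis by (rule landau_o.small.in_cong[THEN iffD2]) simp
  next
    case False
    define P where "P n = poly p (ln (real (Suc n))) / poly p (ln (real n))" for n
    define Q where "Q n = poly q (ln (real (Suc n))) / poly q (ln (real n))" for n
    have P: "(\<lambda>n. real n * (P n - 1)) \<longlonglongrightarrow> 0" unfolding P_def by (rule poly_ln_ratio[OF False])
    have Q: "(\<lambda>n. real n * (Q n - 1)) \<longlonglongrightarrow> 0" unfolding Q_def by (rule poly_ln_ratio[OF q])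
    have Q1: "Q \<longlonglongrightarrow> 1"
    proof (rule Lim_transform_eventually)
      show "(\<lambda>n. real n * (Q n - 1) * (1 / real n) + 1) \<longlonglongrightarrow> 1"
        using tendsto_add[OF tendsto_mult[OF Q lim_1_over_n] tendsto_const[of 1]] by simp
      show "\<forall>\<^sub>F n in sequentially. real n * (Q n - 1) * (1 / real n) + 1 = Q n"
        using eventually_gt_at_top[of 0] by eventually_elim simp
    qed
    have lim: "(\<lambda>n. (real n * (P n - 1) - real n * (Q n - 1)) / Q n) \<longlonglongrightarrow> 0"
      by (rule tendsto_eq_intros P Q Q1 | simp)+
    have p1: "\<forall>\<^sub>F n in sequentially. poly p (ln (real n)) \<noteq> 0"
      using eventually_ln_nat[OF filter_leD[OF at_top_le_at_infinity poly_eventually_not_zero[OF False]]] .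
    have "(\<lambda>n. (r (ln (real (Suc n))) - r (ln (real n))) / (r (ln (real n)) / real n)) \<longlonglongrightarrow> 0"
      using lim
    proof (rule Lim_transform_eventually)
      show "\<forall>\<^sub>F n in sequentially. (real n * (P n - 1) - real n * (Q n - 1)) / Q n =
        (r (ln (real (Suc n))) - r (ln (real n))) / (r (ln (real n)) / real n)"
        using r1 r2 p1 eventually_gt_at_top[of 0]
        by eventually_elim (simp add: P_def Q_def field_simps)
    qed
    then show ?thesis
      by (rule smalloI_tendsto)
         (use r1 p1 eventually_gt_at_top[of 0] in \<open>eventually_elim, simp\<close>)
  qed
qed

lemma rational_ln_smallo_powr:
  assumes "rational_function r" "\<epsilon> > 0"
  shows "(\<lambda>n. r (ln (real n))) \<in> o(\<lambda>n. real n powr \<epsilon>)"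
proof -
  obtain p q where q: "q \<noteq> 0"
    and r: "\<forall>\<^sub>F x in at_top. poly q x \<noteq> 0 \<and> r x = poly p x / poly q x"
    using assms(1) by (rule rational_function_eventually)
  have "(\<lambda>n. poly p (ln (real n)) * (1 / poly q (ln (real n)))) \<in> o(\<lambda>n. real n powr \<epsilon> * 1)"
    by (intro landau_o.small_big_mult poly_ln_smallo_powr inverse_poly_ln_bounded q assms)
  moreover have "\<forall>\<^sub>F n in sequentially. r (ln (real n)) = poly p (ln (real n)) * (1 / poly q (ln (real n)))"
    using eventually_ln_nat[OF r] by eventually_elim simp
  ultimately show ?thesis by (simp add: landau_o.small.in_cong)
qed

text \<open>Numerator and denominator exchange roles; that \<open>r\<close> does not vanish near
  infinity makes the numerator a nonzero polynomial. So \<open>r (ln n)\<close> can tend to 0 only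
  more slowly than every negative power of \<open>n\<close>.\<close>

lemma inverse_rational_ln_smallo_powr:
  assumes "rational_function r" "\<forall>\<^sub>F x in at_top. r x \<noteq> 0" "\<epsilon> > 0"
  shows "(\<lambda>n. 1 / r (ln (real n))) \<in> o(\<lambda>n. real n powr \<epsilon>)"
proof -
  obtain p q where q: "q \<noteq> 0"
    and r: "\<forall>\<^sub>F x in at_top. poly q x \<noteq> 0 \<and> r x = poly p x / poly q x"
    using assms(1) by (rule rational_function_eventually)
  have p: "p \<noteq> 0"
  proof
    assume "p = 0"
    with r have "\<forall>\<^sub>F x in at_top. r x = 0" by (auto elim: eventually_mono)
    with assms(2) have "\<forall>\<^sub>F x::real in at_top. False" by eventually_elim simp
    then show False by simp
  qed
  have "(\<lambda>n. poly q (ln (real n)) * (1 / poly p (ln (real n)))) \<in> o(\<lambda>n. real n powr \<epsilon> * 1)"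
    by (intro landau_o.small_big_mult poly_ln_smallo_powr inverse_poly_ln_bounded p assms)
  moreover have "\<forall>\<^sub>F n in sequentially. 1 / r (ln (real n)) = poly q (ln (real n)) * (1 / poly p (ln (real n)))"
    using eventually_ln_nat[OF r] by eventually_elim simp
  ultimately show ?thesis by (simp add: landau_o.small.in_cong)
qed

lemma log_power_term_bigo:
  assumes "rational_function r" "\<epsilon> > 0"
  shows "(\<lambda>n. r (ln (real n)) / real n powr c) \<in> O(\<lambda>n. real n powr (\<epsilon> - c))"
  using landau_o.big_mult[OF landau_o.small_imp_big[OF rational_ln_smallo_powr[OF assms]] landau_o.big_refl[of "\<lambda>n. 1 / real n powr c"]]
  by (simp add: powr_diff)

text \<open>Discrete product rule: either the power changes, or the rational function does. Both
  changes gain a factor \<open>1/n\<close> over the size of the term.\<close>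

lemma log_power_term_diff_bigo:
  assumes "rational_function r" "\<epsilon> > 0"
  shows "(\<lambda>n. r (ln (real n)) / real n powr c - r (ln (real (Suc n))) / real (Suc n) powr c)
    \<in> O(\<lambda>n. real n powr (\<epsilon> - c - 1))"
proof -
  have R: "(\<lambda>n. r (ln (real n))) \<in> O(\<lambda>n. real n powr \<epsilon>)"
    by (rule landau_o.small_imp_big[OF rational_ln_smallo_powr[OF assms]])
  have 1: "(\<lambda>n. r (ln (real n)) * (1 / real n powr c - 1 / real (Suc n) powr c))
     \<in> O(\<lambda>n. real n powr \<epsilon> * real n powr (- c - 1))"
    by (intro landau_o.big_mult R) real_asymp
  have "(\<lambda>n. r (ln (real n)) / real n) \<in> O(\<lambda>n. real n powr \<epsilon> / real n)"
    using landau_o.big_mult[OF R landau_o.big_refl[of "\<lambda>n. 1 / real n"]] by simp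
  then have "(\<lambda>n. r (ln (real (Suc n))) - r (ln (real n))) \<in> O(\<lambda>n. real n powr \<epsilon> / real n)"
    using rational_ln_step[OF assms(1)] by (meson landau_o.big_trans landau_o.small_imp_big)
  then have 2: "(\<lambda>n. (r (ln (real (Suc n))) - r (ln (real n))) * (1 / real (Suc n) powr c))
     \<in> O(\<lambda>n. (real n powr \<epsilon> / real n) * real n powr (- c))"
    by (rule landau_o.big_mult) real_asymp
  have "(\<lambda>n. real n powr \<epsilon> * real n powr (- c - 1)) \<in> O(\<lambda>n. real n powr (\<epsilon> - c - 1))"
    "(\<lambda>n. real n powr \<epsilon> / real n * real n powr (- c)) \<in> O(\<lambda>n. real n powr (\<epsilon> - c - 1))"
    by real_asymp+
  from sum_in_bigo(2)[OF landau_o.big_trans[OF 1 this(1)] landau_o.big_trans[OF 2 this(2)]]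
  show ?thesis by (simp add: algebra_simps diff_divide_distrib)
qed

section \<open>Arithmetic of relative errors on a bounded scale \<open>e\<close>\<close>

text \<open>From \<open>f g - 1 = (f - 1) (g - 1) + (f - 1) + (g - 1)\<close>; boundedness of
  \<open>e\<close> absorbs the product of the two errors.\<close>

lemma mult_near_1_smallo:
  fixes f g e :: "'a \<Rightarrow> real"
  assumes f: "(\<lambda>n. f n - 1) \<in> o[F](e)" and g: "(\<lambda>n. g n - 1) \<in> o[F](e)"
    and e: "e \<in> O[F](\<lambda>_. 1)"
  shows "(\<lambda>n. f n * g n - 1) \<in> o[F](e)"
proof -
  have "(\<lambda>n. (f n - 1) * (g n - 1)) \<in> o[F](\<lambda>n. e n * 1)"
    using f landau_o.big_trans[OF landau_o.small_imp_big[OF g] e] by (rule landau_o.small_big_mult)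
  then have "(\<lambda>n. (f n - 1) * (g n - 1) + ((f n - 1) + (g n - 1))) \<in> o[F](e)"
    by (intro sum_in_smallo f g) simp
  then show ?thesis by (simp add: algebra_simps)
qed

lemma near_const_bigo_1:
  fixes f e :: "'a \<Rightarrow> real"
  assumes "(\<lambda>n. f n - c) \<in> o[F](e)" "e \<in> O[F](\<lambda>_. 1)"
  shows "f \<in> O[F](\<lambda>_. 1)"
proof -
  have "(\<lambda>n. (f n - c) + c) \<in> O[F](\<lambda>_. 1)"
    using landau_o.big_trans[OF landau_o.small_imp_big[OF assms(1)] assms(2)]
    by (rule sum_in_bigo(1)) simp
  then show ?thesis by simp
qed

section \<open>Algebra of the Turan expression in normalised quantities\<close>

text \<open>With \<open>x = w X\<close> and \<open>y = w Y\<close>, the positive part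
  \<open>2 x y (x + y) - (x y)^2\<close> of the Turan expression is \<open>4 w^3\<close> times this.
  The normalisation makes it tend to 1 when \<open>X\<close> and \<open>Y\<close> tend to 1 and
  \<open>w\<close> to 0.\<close>

definition turan_gain :: "real \<Rightarrow> real \<Rightarrow> real \<Rightarrow> real" where
  "turan_gain w X Y = X * Y * ((X + Y) / 2) - w * (X * Y)\<^sup>2 / 4"

text \<open>The left side is \<open>2 x y (x + y) - (x y)^2 - (x - y)^2\<close> for
  \<open>x = w X\<close>, \<open>y = w Y\<close>, and \<open>x - y = w D / k\<close>. It is applied
  with \<open>k = n\<close>, where \<open>D\<close> is the rescaled difference of consecutive
  terms.\<close>

lemma turan_expression_eq:
  fixes w X D k :: real
  assumes "k \<noteq> 0" "Y = X - D / k"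
  shows "4 * (w * X) * (w * Y) - (1 - (1 - w * X) * (1 - w * Y))\<^sup>2 =
    (w / k)\<^sup>2 * (4 * (k\<^sup>2 * w) * turan_gain w X Y - D\<^sup>2)"
proof -
  have D: "D = k * (X - Y)" using assms by simp
  show ?thesis unfolding D turan_gain_def using assms(1)
    by (simp add: field_simps power2_eq_square)
qed

lemma turan_gain_near_1:
  fixes w X Y D e :: "nat \<Rightarrow> real"
  assumes X: "(\<lambda>n. X n - 1) \<in> o(e)" and D: "(\<lambda>n. D n - c) \<in> o(e)" and w: "w \<in> o(e)"
    and inv: "(\<lambda>n. 1 / real n) \<in> o(e)" and e: "e \<in> O(\<lambda>_. 1)"
    and Y: "\<And>n. Y n = X n - D n / real n"
  shows "(\<lambda>n. turan_gain (w n) (X n) (Y n) - 1) \<in> o(e)"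
proof -
  have "(\<lambda>n. D n * (1 / real n)) \<in> o(\<lambda>n. 1 * e n)"
    by (intro landau_o.big_small_mult near_const_bigo_1[OF D e] inv)
  then have Y1: "(\<lambda>n. Y n - 1) \<in> o(e)"
    using sum_in_smallo(2)[OF X, of "\<lambda>n. D n / real n"] by (simp add: Y algebra_simps)
  have XY: "(\<lambda>n. X n * Y n - 1) \<in> o(e)" by (rule mult_near_1_smallo[OF X Y1 e])
  have "(\<lambda>n. (X n - 1) / 2 + (Y n - 1) / 2) \<in> o(e)"
    by (intro sum_in_smallo) (use X Y1 in simp_all)
  then have "(\<lambda>n. (X n + Y n) / 2 - 1) \<in> o(e)" by (simp add: add_divide_distrib diff_divide_distrib algebra_simps)
  from mult_near_1_smallo[OF XY this e]
  have 1: "(\<lambda>n. X n * Y n * ((X n + Y n) / 2) - 1) \<in> o(e)" .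
  have "(\<lambda>n. X n * Y n) \<in> O(\<lambda>_. 1)" by (rule near_const_bigo_1[OF XY e])
  from landau_o.big_power[OF this, of 2] have "(\<lambda>n. w n * (X n * Y n)\<^sup>2) \<in> o(\<lambda>n. e n * 1)"
    by (intro landau_o.small_big_mult w) simp
  then have 2: "(\<lambda>n. w n * (X n * Y n)\<^sup>2 / 4) \<in> o(e)" by simp
  from sum_in_smallo(2)[OF 1 2] show ?thesis by (simp add: turan_gain_def algebra_simps)
qed

lemma smallo_abs_less:
  fixes f e :: "nat \<Rightarrow> real"
  assumes "f \<in> o(e)" "\<forall>\<^sub>F n in sequentially. e n > 0" "t > 0"
  shows "\<forall>\<^sub>F n in sequentially. \<bar>f n\<bar> \<le> t * e n"
  using landau_o.smallD[OF assms(1,3)] assms(2) by eventually_elim simp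

text \<open>Here \<open>p, q, s, t\<close> stand for four consecutive terms of the sequence. The
  product of the two ratios is \<open>p t / (q s)\<close>, so the squared bracket also depends on
  the ratios alone.\<close>

lemma turan_ratio_form:
  fixes p q s t :: real
  assumes "q \<noteq> 0" "s \<noteq> 0"
  shows "4 * (q\<^sup>2 - p * s) * (s\<^sup>2 - q * t) - (q * s - p * t)\<^sup>2 =
    (q * s)\<^sup>2 * (4 * (1 - p * s / q\<^sup>2) * (1 - q * t / s\<^sup>2)
      - (1 - p * s / q\<^sup>2 * (q * t / s\<^sup>2))\<^sup>2)"
proof -
  define u v where "u = p * s / q\<^sup>2" and "v = q * t / s\<^sup>2"
  have p: "p = u * q\<^sup>2 / s" and t: "t = v * s\<^sup>2 / q" using assms by (simp_all add: u_def v_def)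
  show ?thesis unfolding u_def[symmetric] v_def[symmetric] unfolding p t
    using assms by (simp add: field_simps power2_eq_square)
qed

section \<open>Asymptotics of the leading term and of the full expression\<close>

text \<open>The quotient \<open>w (n+1) / w n\<close> is \<open>R (n+1) / R n\<close> times
  \<open>(n / (n+1))^c\<close>. The power produces the constant \<open>c\<close> up to
  \<open>O(1/n)\<close>, and the variation of \<open>R\<close> is negligible by assumption.\<close>

lemma leading_term_step:
  fixes R e :: "nat \<Rightarrow> real" and c :: real
  assumes R: "\<forall>\<^sub>F n in sequentially. R n > 0"
    and step: "(\<lambda>n. real n * (R (Suc n) - R n) / R n) \<in> o(e)"
    and inv: "(\<lambda>n. 1 / real n) \<in> o(e)"
    and w: "\<And>n. w n = R n / real n powr c"
  shows "(\<lambda>n. real n * (w n - w (Suc n)) / w n - c) \<in> o(e)"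
proof -
  have "(\<lambda>n. real n * (1 - (real n / real (Suc n)) powr c) - c) \<in> O(\<lambda>n. 1 / real n)"
    by real_asymp
  then have 1: "(\<lambda>n. real n * (1 - (real n / real (Suc n)) powr c) - c) \<in> o(e)"
    using inv by (rule landau_o.big_small_trans)
  have "(\<lambda>n. (real n / real (Suc n)) powr c) \<in> O(\<lambda>_. 1)"
    by real_asymp
  from landau_o.small_big_mult[OF step this]
  have 2: "(\<lambda>n. real n * (R (Suc n) - R n) / R n * (real n / real (Suc n)) powr c) \<in> o(e)" by simp
  have "\<forall>\<^sub>F n in sequentially. real n * (w n - w (Suc n)) / w n - c =
     (real n * (1 - (real n / real (Suc n)) powr c) - c)
       - real n * (R (Suc n) - R n) / R n * (real n / real (Suc n)) powr c"
    using R eventually_gt_at_top[of 0]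
  proof eventually_elim
    case (elim n)
    define A B where "A = real n powr c" and "B = real (Suc n) powr c"
    have "A > 0" "B > 0" "R n > 0" using elim unfolding A_def B_def by simp_all
    moreover have "(real n / real (Suc n)) powr c = A / B"
      unfolding A_def B_def by (rule powr_divide)
    ultimately show ?case unfolding w A_def[symmetric] B_def[symmetric]
      by (simp add: field_simps del: of_nat_Suc)
  qed
  then show ?thesis using sum_in_smallo(2)[OF 1 2] by (rule landau_o.small.in_cong[THEN iffD2])
qed

text \<open>The scale \<open>e\<close> is left open because the two cases of the theorem need
  different precision. It may tend to 0, but not faster than \<open>n^(-\<epsilon>)\<close>, so
  every power saving larger than \<epsilon> is negligible against it.\<close>

lemma turan_core:
  fixes R x w e :: "nat \<Rightarrow> real" and c \<epsilon> :: real
  assumes R: "\<forall>\<^sub>F n in sequentially. R n > 0"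
    and \<epsilon>: "0 < \<epsilon>" "\<epsilon> < 1" "2 * \<epsilon> < c"
    and w: "\<And>n. w n = R n / real n powr c"
    and R_upper: "R \<in> o(\<lambda>n. real n powr \<epsilon>)"
    and R_lower: "(\<lambda>n. 1 / R n) \<in> o(\<lambda>n. real n powr \<epsilon>)"
    and step: "(\<lambda>n. real n * (R (Suc n) - R n) / R n) \<in> o(e)"
    and e: "e \<in> O(\<lambda>_. 1)" "(\<lambda>n. real n powr (- \<epsilon>)) \<in> O(e)"
    and rem: "(\<lambda>n. x n - w n) \<in> O(\<lambda>n. real n powr (- c - 3 * \<epsilon>))"
    and rem_diff: "(\<lambda>n. (x n - w n) - (x (Suc n) - w (Suc n))) \<in> O(\<lambda>n. real n powr (- c - 1 - 3 * \<epsilon>))"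
  obtains G D where
    "(\<lambda>n. G n - 1) \<in> o(e)" "(\<lambda>n. D n - c) \<in> o(e)"
    "\<forall>\<^sub>F n in sequentially. 4 * x n * x (Suc n) - (1 - (1 - x n) * (1 - x (Suc n)))\<^sup>2
      = (w n / real n)\<^sup>2 * (4 * ((real n)\<^sup>2 * w n) * G n - (D n)\<^sup>2)"
proof -
  have eps: "f \<in> O(\<lambda>n. real n powr b) \<Longrightarrow> b < - \<epsilon> \<Longrightarrow> f \<in> o(e)" for f b
    by (rule landau_o.big_small_trans, assumption, rule landau_o.small_big_trans[OF _ e(2)]) real_asymp
  have inv: "(\<lambda>n. 1 / real n) \<in> o(e)"
    by (rule eps[of _ "-1"]) (use \<epsilon> in real_asymp, use \<epsilon> in simp)
  have "(\<lambda>n. R n * real n powr (- c)) \<in> O(\<lambda>n. real n powr \<epsilon> * real n powr (- c))"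
    by (intro landau_o.big_mult landau_o.small_imp_big[OF R_upper]) simp
  \<comment> \<open>The exponent \<open>\<epsilon> - c\<close> lies below
    \<open>- \<epsilon>\<close> because \<open>2 * \<epsilon> < c\<close>.\<close>
  then have wo: "w \<in> o(e)"
    by (intro eps[of _ "\<epsilon> - c"])
       (use \<epsilon> in \<open>simp_all add: w[abs_def] powr_minus powr_diff field_simps\<close>)
  have "(\<lambda>n. 1 / R n * real n powr c) \<in> O(\<lambda>n. real n powr \<epsilon> * real n powr c)"
    by (intro landau_o.big_mult landau_o.small_imp_big[OF R_lower]) simp
  then have iw: "(\<lambda>n. 1 / w n) \<in> O(\<lambda>n. real n powr \<epsilon> * real n powr c)"
    by (simp add: w[abs_def])
  define X D where "X n = x n / w n" and "D n = real n * (x n - x (Suc n)) / w n" for n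
  have w_pos: "\<forall>\<^sub>F n in sequentially. real n > 0 \<and> w n > 0"
    using R eventually_gt_at_top[of 0] by eventually_elim (simp add: w)
  have X: "(\<lambda>n. X n - 1) \<in> o(e)"
  proof -
    \<comment> \<open>Dividing by \<open>w\<close> costs \<open>n^(c + \<epsilon>)\<close>. The
      \<open>3 * \<epsilon>\<close> in the remainder bounds thus leaves
      \<open>n^(-2 \<epsilon>)\<close>, strictly below the threshold in \<open>eps\<close>; the same
      count serves for \<open>D\<close>.\<close>
    have "(\<lambda>n. (x n - w n) * (1 / w n)) \<in> O(\<lambda>n. real n powr (- c - 3 * \<epsilon>) * (real n powr \<epsilon> * real n powr c))"
      by (rule landau_o.big_mult[OF rem iw])
    then have "(\<lambda>n. (x n - w n) * (1 / w n)) \<in> o(e)"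
      by (intro eps[of _ "- 2 * \<epsilon>"]) (use \<epsilon> in \<open>simp_all flip: powr_add\<close>)
    moreover have "\<forall>\<^sub>F n in sequentially. X n - 1 = (x n - w n) * (1 / w n)"
      using w_pos by eventually_elim (simp add: X_def field_simps)
    ultimately show ?thesis by (rule landau_o.small.in_cong[THEN iffD2, rotated])
  qed
  have D: "(\<lambda>n. D n - c) \<in> o(e)"
  proof -
    have "(\<lambda>n. real n powr 1 * ((x n - w n) - (x (Suc n) - w (Suc n))) * (1 / w n))
        \<in> O(\<lambda>n. real n powr 1 * real n powr (- c - 1 - 3 * \<epsilon>) * (real n powr \<epsilon> * real n powr c))"
      by (intro landau_o.big_mult rem_diff iw landau_o.big_refl)
    also have "(\<lambda>n. real n powr 1 * real n powr (- c - 1 - 3 * \<epsilon>) * (real n powr \<epsilon> * real n powr c))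
        \<in> O(\<lambda>n. real n powr (- 2 * \<epsilon>))"
      by real_asymp
    finally have "(\<lambda>n. real n powr 1 * ((x n - w n) - (x (Suc n) - w (Suc n))) * (1 / w n)) \<in> o(e)"
      by (rule eps) (use \<epsilon> in simp)
    from sum_in_smallo(1)[OF leading_term_step[OF R step inv w] this]
    have "(\<lambda>n. real n * (w n - w (Suc n)) / w n - c
        + real n powr 1 * ((x n - w n) - (x (Suc n) - w (Suc n))) * (1 / w n)) \<in> o(e)" .
    moreover have "\<forall>\<^sub>F n in sequentially. D n - c = real n * (w n - w (Suc n)) / w n - c
        + real n powr 1 * ((x n - w n) - (x (Suc n) - w (Suc n))) * (1 / w n)"
      using w_pos by eventually_elim (simp add: D_def field_simps)
    ultimately show ?thesis by (rule landau_o.small.in_cong[THEN iffD2, rotated])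
  qed
  \<comment> \<open>This is \<open>x (Suc n) / w n\<close> when \<open>w n\<close> is nonzero: both
    terms are normalised by the same \<open>w n\<close>, not by \<open>w (Suc n)\<close>.\<close>
  define Y where "Y n = X n - D n / real n" for n
  have "\<forall>\<^sub>F n in sequentially. 4 * x n * x (Suc n) - (1 - (1 - x n) * (1 - x (Suc n)))\<^sup>2
      = (w n / real n)\<^sup>2 * (4 * ((real n)\<^sup>2 * w n) * turan_gain (w n) (X n) (Y n) - (D n)\<^sup>2)"
    using w_pos
  proof eventually_elim
    case (elim n)
    have "x n = w n * X n" "x (Suc n) = w n * Y n"
      using elim by (simp_all add: X_def Y_def D_def field_simps)
    with turan_expression_eq[of "real n" "Y n" "X n" "D n" "w n"] elim show ?case
      by (simp add: Y_def mult.assoc)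
  qed
  with turan_gain_near_1[OF X D wo inv e(1) Y_def] D show ?thesis by (rule that)
qed

section \<open>Choice of exponents, remainder estimates and the two cases for the leading
  exponent\<close>

theorem theorem2p2:
  fixes a :: "nat \<Rightarrow> real" and m :: nat and \<alpha> :: "nat \<Rightarrow> real" and \<beta> :: real
    and r :: "nat \<Rightarrow> real \<Rightarrow> real"
  assumes nonzero: "\<forall>\<^sub>F n in sequentially. a n \<noteq> 0"
    and m: "m \<ge> 1"
    and \<alpha>_pos: "0 < \<alpha> 1"
    and \<alpha>_mono: "strict_mono_on {1..m} \<alpha>"
    and \<beta>: "\<alpha> m < \<beta>"
    and rational: "\<And>i. i \<in> {1..m} \<Longrightarrow> rational_function (r i)"
    and expansion:
      "(\<lambda>n. a (n - 1) * a (n + 1) / (a n)\<^sup>2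
              - (1 + (\<Sum>i=1..m. r i (ln (real n)) / real n powr \<alpha> i)))
         \<in> o(\<lambda>n. 1 / real n powr \<beta>)"
    and gap: "\<alpha> m - \<alpha> 1 \<ge> 1"
    and cases: "(0 < \<alpha> 1 \<and> \<alpha> 1 < 2 \<and> (\<forall>\<^sub>F x in at_top. r 1 x < 0)) \<or>
                (\<alpha> 1 = 2 \<and> (\<forall>\<^sub>F x in at_top. r 1 x < -1))"
  shows "higher_order_turan_asymptotically a"
proof -
  define c where "c = \<alpha> 1"
  have m2: "m \<ge> 2"
  proof (rule ccontr)
    assume "\<not> m \<ge> 2"
    then have "m = 1" using m by simp
    then show False using gap by simp
  qed
  have \<alpha>12: "\<alpha> 1 < \<alpha> 2" using m2 by (intro strict_mono_onD[OF \<alpha>_mono]) auto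
  have \<alpha>2: "\<alpha> 2 \<le> \<alpha> i" if "i \<in> {2..m}" for i
    using that strict_mono_onD[OF \<alpha>_mono, of 2 i] by (cases "i = 2") auto
  \<comment> \<open>All four entries are positive; \<open>\<beta> - c - 1\<close> is so because
    \<open>\<beta> > \<alpha> m \<ge> c + 1\<close>. The estimates below need at most
    \<open>4 * \<epsilon>\<close> of room, and the divisor 5 makes the inequalities strict.\<close>
  define \<epsilon> where "\<epsilon> = Min {\<alpha> 2 - c, \<beta> - c - 1, c, 1} / 5"
  have "0 < 5 * \<epsilon>" "5 * \<epsilon> \<le> \<alpha> 2 - c" "5 * \<epsilon> \<le> \<beta> - c - 1" "5 * \<epsilon> \<le> c" "5 * \<epsilon> \<le> 1"
    using \<alpha>12 \<alpha>_pos \<beta> gap by (auto simp: \<epsilon>_def c_def)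
  then have \<epsilon>: "0 < \<epsilon>" "5 * \<epsilon> \<le> \<alpha> 2 - c" "5 * \<epsilon> \<le> \<beta> - c - 1" "2 * \<epsilon> < c" "\<epsilon> < 1"
    by linarith+
  define f where "f x = - r 1 x" for x
  have rf: "rational_function f"
    unfolding f_def by (intro rational_function_minus rational) (use m in auto)
  define R where "R n = f (ln (real n))" for n :: nat
  have f_pos: "\<forall>\<^sub>F x in at_top. f x > 0"
    using cases by (auto simp: f_def elim: eventually_mono)
  have R_pos: "\<forall>\<^sub>F n in sequentially. R n > 0"
    unfolding R_def by (rule eventually_ln_nat[OF f_pos])
  have f_nz: "\<forall>\<^sub>F x in at_top. f x \<noteq> 0" using f_pos by eventually_elim simp
  have R_upper: "R \<in> o(\<lambda>n. real n powr \<delta>)" if "\<delta> > 0" for \<delta>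
    using rational_ln_smallo_powr[OF rf that] by (simp add: R_def[abs_def])
  have R_lower: "(\<lambda>n. 1 / R n) \<in> o(\<lambda>n. real n powr \<delta>)" if "\<delta> > 0" for \<delta>
    using inverse_rational_ln_smallo_powr[OF rf f_nz that] by (simp add: R_def[abs_def])
  define w where "w n = R n / real n powr c" for n
  define v where "v n = a (n - 1) * a (n + 1) / (a n)\<^sup>2" for n
  define x where "x n = 1 - v n" for n
  define \<rho> where "\<rho> n = v n - (1 + (\<Sum>i=1..m. r i (ln (real n)) / real n powr \<alpha> i))" for n
  define g where "g n = (\<Sum>i=2..m. r i (ln (real n)) / real n powr \<alpha> i)" for n
  have "{1..m} = insert 1 {2..m}" using m by auto
  then have xw: "x n - w n = - (g n + \<rho> n)" for n
    by (simp add: x_def \<rho>_def g_def w_def R_def f_def c_def)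
  \<comment> \<open>Only the size of \<open>\<rho>\<close> is known, so its difference gains no
    factor \<open>1/n\<close>. The order required of differences must already hold for
    \<open>\<rho>\<close> itself, which is where \<open>\<beta> > c + 1\<close> enters.\<close>
  have \<rho>: "\<rho> \<in> O(\<lambda>n. real n powr (- c - 1 - 3 * \<epsilon>))"
  proof -
    have "\<rho> \<in> O(\<lambda>n. 1 / real n powr \<beta>)"
      using landau_o.small_imp_big[OF expansion] by (simp add: \<rho>_def[abs_def] v_def)
    also have "(\<lambda>n. 1 / real n powr \<beta>) \<in> O(\<lambda>n. real n powr (- c - 1 - 3 * \<epsilon>))"
    proof -
      have "- \<beta> < - c - 1 - 3 * \<epsilon>" using \<epsilon> by linarith
      then have "(\<lambda>n. real n powr - \<beta>) \<in> O(\<lambda>n. real n powr (- c - 1 - 3 * \<epsilon>))" by real_asymp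
      then show ?thesis by (simp add: powr_minus_divide)
    qed
    finally show ?thesis .
  qed
  have \<rho>_Suc: "(\<lambda>n. \<rho> (Suc n)) \<in> O(\<lambda>n. real n powr (- c - 1 - 3 * \<epsilon>))"
  proof -
    have "(\<lambda>n. \<rho> (Suc n)) \<in> O(\<lambda>n. real (Suc n) powr (- c - 1 - 3 * \<epsilon>))"
      by (rule landau_o.big.compose[OF \<rho> filterlim_Suc])
    also have "(\<lambda>n. real (Suc n) powr (- c - 1 - 3 * \<epsilon>)) \<in> O(\<lambda>n. real n powr (- c - 1 - 3 * \<epsilon>))"
      by real_asymp
    finally show ?thesis .
  qed
  have g: "g \<in> O(\<lambda>n. real n powr (- c - 3 * \<epsilon>))"
    unfolding g_def[abs_def]
  proof (rule big_sum_in_bigo)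
    fix i assume i: "i \<in> {2..m}"
    then have "\<epsilon> - \<alpha> i < - c - 3 * \<epsilon>" using \<alpha>2[OF i] \<epsilon> by linarith
    then have "(\<lambda>n. real n powr (\<epsilon> - \<alpha> i)) \<in> O(\<lambda>n. real n powr (- c - 3 * \<epsilon>))" by real_asymp
    moreover have "i \<in> {1..m}" using i by simp
    ultimately show "(\<lambda>n. r i (ln (real n)) / real n powr \<alpha> i) \<in> O(\<lambda>n. real n powr (- c - 3 * \<epsilon>))"
      by (rule landau_o.big_trans[OF log_power_term_bigo[OF rational \<epsilon>(1)], rotated])
  qed
  \<comment> \<open>Unlike \<open>\<rho>\<close>, the explicit terms vary slowly, so
    \<open>\<alpha> 2 > c\<close> suffices for the extra factor \<open>1/n\<close>.\<close>
  have g_diff: "(\<lambda>n. g n - g (Suc n)) \<in> O(\<lambda>n. real n powr (- c - 1 - 3 * \<epsilon>))"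
    unfolding g_def sum_subtractf[symmetric]
  proof (rule big_sum_in_bigo)
    fix i assume i: "i \<in> {2..m}"
    then have "\<epsilon> - \<alpha> i - 1 < - c - 1 - 3 * \<epsilon>" using \<alpha>2[OF i] \<epsilon> by linarith
    then have "(\<lambda>n. real n powr (\<epsilon> - \<alpha> i - 1)) \<in> O(\<lambda>n. real n powr (- c - 1 - 3 * \<epsilon>))" by real_asymp
    moreover have "i \<in> {1..m}" using i by simp
    ultimately show "(\<lambda>n. r i (ln (real n)) / real n powr \<alpha> i - r i (ln (real (Suc n))) / real (Suc n) powr \<alpha> i)
        \<in> O(\<lambda>n. real n powr (- c - 1 - 3 * \<epsilon>))"
      by (rule landau_o.big_trans[OF log_power_term_diff_bigo[OF rational \<epsilon>(1)], rotated])
  qed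
  have "(\<lambda>n. real n powr (- c - 1 - 3 * \<epsilon>)) \<in> O(\<lambda>n. real n powr (- c - 3 * \<epsilon>))" by real_asymp
  from sum_in_bigo(1)[OF g landau_o.big_trans[OF \<rho> this]]
  have rem: "(\<lambda>n. x n - w n) \<in> O(\<lambda>n. real n powr (- c - 3 * \<epsilon>))"
    by (simp only: xw landau_o.big.uminus_in_iff)
  have "(x n - w n) - (x (Suc n) - w (Suc n)) = - ((g n - g (Suc n)) + (\<rho> n - \<rho> (Suc n)))" for n
    by (simp add: xw)
  then have rem_diff: "(\<lambda>n. (x n - w n) - (x (Suc n) - w (Suc n))) \<in> O(\<lambda>n. real n powr (- c - 1 - 3 * \<epsilon>))"
    using sum_in_bigo(1)[OF g_diff sum_in_bigo(2)[OF \<rho> \<rho>_Suc]]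
    by (simp only: landau_o.big.uminus_in_iff)
  define E where "E n = 4 * x n * x (Suc n) - (1 - (1 - x n) * (1 - x (Suc n)))\<^sup>2" for n
  have reduce: "\<forall>\<^sub>F n in sequentially. E n \<ge> 0 \<Longrightarrow> higher_order_turan_asymptotically a"
  proof -
    assume "\<forall>\<^sub>F n in sequentially. E n \<ge> 0"
    moreover have "\<forall>\<^sub>F n in sequentially. a (Suc n) \<noteq> 0"
      using nonzero by (rule eventually_sequentially_Suc[THEN iffD2])
    ultimately show ?thesis unfolding higher_order_turan_asymptotically_def using nonzero
    proof eventually_elim
      case (elim n)
      have "4 * ((a n)\<^sup>2 - a (n - 1) * a (n + 1)) * ((a (n + 1))\<^sup>2 - a n * a (n + 2))
          - (a n * a (n + 1) - a (n - 1) * a (n + 2))\<^sup>2 = (a n * a (n + 1))\<^sup>2 * E n"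
        using turan_ratio_form[of "a n" "a (n + 1)" "a (n - 1)" "a (n + 2)"] elim
        by (simp add: E_def x_def v_def)
      then show ?case using elim by simp
    qed
  qed
  \<comment> \<open>Used with \<open>e = 1\<close> in the first case and
    \<open>e = (R - 1) / R\<close> in the second; \<open>1/8\<close> is small enough for the closing
    numerical estimates of both.\<close>
  have core: thesis
    if e: "\<forall>\<^sub>F n in sequentially. 0 < e n \<and> e n \<le> 1" "(\<lambda>n. real n powr (- \<epsilon>)) \<in> O(e)"
      and step: "(\<lambda>n. real n * (R (Suc n) - R n) / R n) \<in> o(e)"
      and that: "\<And>G D. \<lbrakk>\<forall>\<^sub>F n in sequentially. \<bar>G n - 1\<bar> \<le> 1 / 8 * e n;
        \<forall>\<^sub>F n in sequentially. \<bar>D n - c\<bar> \<le> 1 / 8 * e n;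
        \<forall>\<^sub>F n in sequentially. E n = (w n / real n)\<^sup>2 * (4 * ((real n)\<^sup>2 * w n) * G n - (D n)\<^sup>2)\<rbrakk> \<Longrightarrow> thesis"
    for e thesis
  proof -
    have "\<forall>\<^sub>F n in sequentially. norm (e n) \<le> 1 * norm (1::real)"
      using e(1) by eventually_elim auto
    then have e1: "e \<in> O(\<lambda>_. 1)" by (rule bigoI)
    have e_pos: "\<forall>\<^sub>F n in sequentially. e n > 0" using e(1) by eventually_elim simp
    obtain G D where G: "(\<lambda>n. G n - 1) \<in> o(e)" and D: "(\<lambda>n. D n - c) \<in> o(e)"
      and E: "\<forall>\<^sub>F n in sequentially. E n = (w n / real n)\<^sup>2 * (4 * ((real n)\<^sup>2 * w n) * G n - (D n)\<^sup>2)"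
      using turan_core[OF R_pos \<epsilon>(1,5,4) w_def R_upper[OF \<epsilon>(1)] R_lower[OF \<epsilon>(1)] step e1 e(2) rem rem_diff]
      unfolding E_def by blast
    show thesis
      using smallo_abs_less[OF G e_pos, of "1/8"] smallo_abs_less[OF D e_pos, of "1/8"] E
      by (intro that[of G D]) simp_all
  qed
  \<comment> \<open>Applied with \<open>u = R\<close> and with \<open>u = R - 1\<close>: both have
    the same increments, but the second choice gives the finer bound
    \<open>o((R - 1) / R)\<close>.\<close>
  have stepR: "(\<lambda>n. real n * s n / R n) \<in> o(\<lambda>n. u n / R n)"
    if "s \<in> o(\<lambda>n. u n / real n)" for s u
  proof -
    have "(\<lambda>n. (real n / R n) * s n) \<in> o(\<lambda>n. (real n / R n) * (u n / real n))"
      by (rule landau_o.big_small_mult[OF landau_o.big_refl that])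
    also have "(\<lambda>n. (real n / R n) * (u n / real n)) \<in> O(\<lambda>n. u n / R n)"
      by (rule bigoI[of _ 1], use eventually_gt_at_top[of 0] in eventually_elim) simp
    finally show ?thesis by simp
  qed
  from cases show ?thesis
  proof
    assume *: "0 < \<alpha> 1 \<and> \<alpha> 1 < 2 \<and> (\<forall>\<^sub>F x in at_top. r 1 x < 0)"
    have "(\<lambda>n. R n / R n) \<in> O(\<lambda>_. 1)"
      by (rule bigoI[of _ 1], use R_pos in eventually_elim) simp
    with stepR[OF rational_ln_step[OF rf, folded R_def]]
    have step: "(\<lambda>n. real n * (R (Suc n) - R n) / R n) \<in> o(\<lambda>_. 1)"
      by (rule landau_o.small_big_trans)
    have pow: "(\<lambda>n. real n powr (- \<epsilon>)) \<in> O(\<lambda>_. 1)" using \<epsilon>(1) by real_asymp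
    obtain G D where G: "\<forall>\<^sub>F n in sequentially. \<bar>G n - 1\<bar> \<le> 1 / 8 * 1"
      and D: "\<forall>\<^sub>F n in sequentially. \<bar>D n - c\<bar> \<le> 1 / 8 * 1"
      and E: "\<forall>\<^sub>F n in sequentially. E n = (w n / real n)\<^sup>2 * (4 * ((real n)\<^sup>2 * w n) * G n - (D n)\<^sup>2)"
      by (rule core[OF _ pow step]) auto
    have "2 - c > 0" using * by (simp add: c_def)
    \<comment> \<open>The factor \<open>1/4\<close> yields \<open>n^2 w \<ge> 4\<close>, so the
      positive part is at least \<open>4 * 4 * 7/8 = 14\<close>, while \<open>c < 2\<close> gives
      \<open>\<bar>D\<bar> \<le> 3\<close> and hence \<open>D^2 \<le> 9\<close>.\<close>
    then have "\<forall>\<^sub>F n in sequentially. norm (1 / R n) \<le> 1/4 * norm (real n powr (2 - c))"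
      using landau_o.smallD[OF R_lower, of "2 - c" "1/4"] by simp
    with G D E R_pos eventually_gt_at_top[of 0] have "\<forall>\<^sub>F n in sequentially. E n \<ge> 0"
    proof eventually_elim
      case (elim n)
      have "4 \<le> R n * real n powr (2 - c)" using elim by (simp add: field_simps)
      also have "\<dots> = (real n)\<^sup>2 * w n" using elim
        by (simp add: w_def powr_diff)
      finally have W: "4 \<le> (real n)\<^sup>2 * w n" .
      have "c < 2" "c > 0" using * by (auto simp: c_def)
      then have "\<bar>D n\<bar> \<le> 3" using elim by linarith
      then have "(D n)\<^sup>2 \<le> 3\<^sup>2" by (intro abs_le_square_iff[THEN iffD1]) simp
      then have "(D n)\<^sup>2 \<le> 9" by simp
      moreover have "4 * (4::real) * (7/8) \<le> 4 * ((real n)\<^sup>2 * w n) * G n"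
        using elim W by (intro mult_mono) linarith+
      ultimately have "0 \<le> 4 * ((real n)\<^sup>2 * w n) * G n - (D n)\<^sup>2" by linarith
      then have "0 \<le> (w n / real n)\<^sup>2 * (4 * ((real n)\<^sup>2 * w n) * G n - (D n)\<^sup>2)"
        by (intro mult_nonneg_nonneg) simp_all
      with elim show ?case by simp
    qed
    then show ?thesis by (rule reduce)
  next
    assume *: "\<alpha> 1 = 2 \<and> (\<forall>\<^sub>F x in at_top. r 1 x < -1)"
    then have f1: "\<forall>\<^sub>F x in at_top. f x - 1 > 0" by (auto simp: f_def elim: eventually_mono)
    then have f1_nz: "\<forall>\<^sub>F x in at_top. f x - 1 \<noteq> 0" by eventually_elim simp
    have R1: "\<forall>\<^sub>F n in sequentially. R n - 1 > 0"
      unfolding R_def by (rule eventually_ln_nat[OF f1])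
    \<comment> \<open>This is the available margin \<open>4 (R - 1)\<close> relative to the main
      term \<open>4 R\<close>, the precision needed when \<open>R\<close> approaches 1.\<close>
    define e where "e n = (R n - 1) / R n" for n
    have e: "\<forall>\<^sub>F n in sequentially. 0 < e n \<and> e n \<le> 1"
      using R1 by eventually_elim (simp add: e_def)
    have step: "(\<lambda>n. real n * (R (Suc n) - R n) / R n) \<in> o(e)"
      using stepR[OF rational_ln_step[OF rational_function_diff_1[OF rf]]]
      by (simp add: R_def[abs_def] e_def[abs_def])
    \<comment> \<open>The factors of \<open>1 / e = R / (R - 1)\<close> receive half of \<epsilon>
      each, so \<open>e\<close> does not decay faster than \<open>n^(-\<epsilon>)\<close>.\<close>
    have "(\<lambda>n. 1 / (R n - 1) * R n) \<in> O(\<lambda>n. real n powr (\<epsilon>/2) * real n powr (\<epsilon>/2))"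
      using inverse_rational_ln_smallo_powr[OF rational_function_diff_1[OF rf] f1_nz, of "\<epsilon>/2"] R_upper[of "\<epsilon>/2"] \<epsilon>(1)
      by (intro landau_o.big_mult landau_o.small_imp_big) (simp_all add: R_def[abs_def])
    then have inv_e: "(\<lambda>n. inverse (e n)) \<in> O(\<lambda>n. real n powr \<epsilon>)"
      by (simp add: e_def flip: powr_add)
    have pow: "(\<lambda>n. real n powr (- \<epsilon>)) \<in> O(e)"
    proof -
      have "(\<lambda>n. inverse (real n powr \<epsilon>)) \<in> O(\<lambda>n. inverse (inverse (e n)))"
        using inv_e
      proof (rule landau_o.big.inverse[rotated 2])
        show "\<forall>\<^sub>F n in sequentially. inverse (e n) \<noteq> 0" using e by eventually_elim auto
        show "\<forall>\<^sub>F n in sequentially. real n powr \<epsilon> \<noteq> 0"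
          using eventually_gt_at_top[of 0] by eventually_elim auto
      qed
      then show ?thesis by (simp add: powr_minus)
    qed
    obtain G D where G: "\<forall>\<^sub>F n in sequentially. \<bar>G n - 1\<bar> \<le> 1 / 8 * e n"
      and D: "\<forall>\<^sub>F n in sequentially. \<bar>D n - c\<bar> \<le> 1 / 8 * e n"
      and E: "\<forall>\<^sub>F n in sequentially. E n = (w n / real n)\<^sup>2 * (4 * ((real n)\<^sup>2 * w n) * G n - (D n)\<^sup>2)"
      by (rule core[OF e pow step]) auto
    from G D E R1 e eventually_gt_at_top[of 0] have "\<forall>\<^sub>F n in sequentially. E n \<ge> 0"
    proof eventually_elim
      case (elim n)
      have W: "(real n)\<^sup>2 * w n = R n" using * elim by (simp add: w_def c_def)
      have Re: "R n * e n = R n - 1" using elim by (simp add: e_def)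
      have "0 < e n" "e n \<le> 1" using elim by auto
      have "e n * 1 \<le> e n * R n" using elim by (intro mult_left_mono) auto
      then have eR: "e n \<le> R n - 1" using Re by (simp add: mult.commute)
      have "\<bar>D n\<bar> \<le> 2 + e n / 8" using elim * unfolding c_def by linarith
      then have "(D n)\<^sup>2 \<le> (2 + e n / 8)\<^sup>2"
        using \<open>0 < e n\<close> by (intro abs_le_square_iff[THEN iffD1]) simp
      also have "\<dots> = 4 + e n / 2 + e n * e n / 64" by (simp add: power2_eq_square field_simps)
      also have "e n * e n \<le> e n * 1" using elim by (intro mult_left_mono) auto
      finally have "(D n)\<^sup>2 \<le> 4 + e n" using \<open>0 < e n\<close> by simp
      moreover have "R n * (1 - e n / 8) \<le> R n * G n"
        using elim by (intro mult_left_mono) linarith+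
      then have "R n - (R n - 1) / 8 \<le> R n * G n" using Re by (simp add: algebra_simps)
      \<comment> \<open>The error in \<open>G\<close> costs at most \<open>(R - 1) / 2\<close> and
        the error in \<open>D\<close> at most \<open>e \<le> R - 1\<close>, out of the margin
        \<open>4 (R - 1)\<close>.\<close>
      ultimately have "0 \<le> 4 * (R n * G n) - (D n)\<^sup>2"
        using eR elim(4) by argo
      then have "0 \<le> 4 * ((real n)\<^sup>2 * w n) * G n - (D n)\<^sup>2"
        unfolding W by (simp add: mult.assoc)
      then have "0 \<le> (w n / real n)\<^sup>2 * (4 * ((real n)\<^sup>2 * w n) * G n - (D n)\<^sup>2)"
        by (intro mult_nonneg_nonneg) simp_all
      with elim show ?case by simp
    qed
    then show ?thesis by (rule reduce)
  qed
qed

end
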